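(* Let $(X,d)$ be a finite nonempty ultrametric space with $|X|=n$ and representing tree $T_X$. Then for any minimum spanning path $P\in\mathfrak{P}_{min}(X)$ with $V(P)=\{x_1,\dots,x_n\}$ (numbered consecutively along $P$) and path spectrum $\mathcal{PS}(P)=(s_1,\dots,s_{n-1})$ the following conditions are equivalent. (i) $T_X$ is strictly binary. (ii) If $s_i=s_j$, $1\le i<j\le n-1$, then there exists $k$ with $i<k<j$ such that $s_k>s_i=s_j$.
   Context: An ultrametric space $(X,d)$ is a metric space with $d(x,y)\le\max\{d(x,z),d(z,y)\}$ for all $x,y,z$. Minimum spanning paths: a finite metric space $(X,d)$ is regarded as the complete weighted graph $(G_X,w)$ with $V(G_X)=X$ and $w(\{x,y\})=d(x,y)$ for $x\ne y$. A minimum spanning tree of $(X,d)$ is a spanning tree of $G_X$ whose sum of edge weights is smallest among all spanning trees. $\mathfrak{P}_{min}(X)$ is the set of all minimum spanning paths, i.e. minimum spanning trees that are paths (a path is a nonempty graph with vertices $x_1,\dots,x_n$ and edges exactly $\{x_1,x_2\},\dots,\{x_{n-1},x_n\}$; a single vertex is allowed). For $P\in\mathfrak{P}_{min}(X)$ with vertices numbered $x_1,\dots,x_n$ along $P$, the path spectrum is $\mathcal{PS}(P)=(s_1,\dots,s_{n-1})$, $s_i=d(x_i,x_{i+1})$. Representing tree: for a finite ultrametric space $X$ with $|X|\ge 2$, the diametrical graph $G_{D,X}$ has vertex set $X$, with $u,v$ adjacent iff $d(u,v)=\operatorname{diam}X$; it is known to be a complete multipartite graph with parts $X_1,\dots,X_k$,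 $k\ge2$ (the parts are the classes of the equivalence relation $d(u,v)<\operatorname{diam}X$). The representing tree $T_X$ is the labeled rooted tree whose nodes are subsets of $X$, constructed as follows: the root is $X$ with label $\operatorname{diam}X$; if $|X|=1$, $T_X$ consists of the root only (a leaf, with label $0$); if $|X|\ge2$, the children of the root are the parts $X_1,\dots,X_k$ of $G_{D,X}$, each labeled $l(X_i)=\operatorname{diam}X_i$; nodes of label $0$ (singletons) are leaves, nodes of positive label are internal nodes, and the construction is repeated at each internal node $X_i$, using the subspace $X_i$ in place of $X$, and so on. A rooted tree is strictly binary if every internal node has exactly two children. *)

theory Defs
  imports "HOL-Analysis.Analysis"
begin

section \<open>Ultrametric spaces\<close>

locale Ultrametric_space = Metric_space +
  assumes ultra: "\<lbrakk>x \<in> M; y \<in> M; z \<in> M\<rbrakk> \<Longrightarrow> d x y \<le> max (d x z) (d z y)"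

text \<open>The library's \<open>diameter\<close> is tied to the type class of metric spaces;
  this is its analogue for an explicit distance function (used on finite nonempty sets).\<close>

definition diam :: "('a \<Rightarrow> 'a \<Rightarrow> real) \<Rightarrow> 'a set \<Rightarrow> real" where
  "diam d A = (SUP (x, y) \<in> A \<times> A. d x y)"


section \<open>Undirected simple graphs\<close>

record 'a ugraph =
  verts :: "'a set"
  edges :: "'a set set"

definition ugraph :: "'a ugraph \<Rightarrow> bool" where
  "ugraph G \<longleftrightarrow> (\<forall>e \<in> edges G. \<exists>u v. u \<in> verts G \<and> v \<in> verts G \<and> u \<noteq> v \<and> e = {u, v})"

definition ugraph_connected :: "'a ugraph \<Rightarrow> bool" where
  "ugraph_connected G \<longleftrightarrow>
     (\<forall>u \<in> verts G. \<forall>v \<in> verts G. (u, v) \<in> {(a, b). {a, b} \<in> edges G}\<^sup>*)"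

definition ugraph_cycle :: "'a ugraph \<Rightarrow> 'a list \<Rightarrow> bool" where
  "ugraph_cycle G cs \<longleftrightarrow> 3 \<le> length cs \<and> distinct cs \<and>
     (\<forall>i < length cs. {cs ! i, cs ! (Suc i mod length cs)} \<in> edges G)"

definition ugraph_tree :: "'a ugraph \<Rightarrow> bool" where
  "ugraph_tree G \<longleftrightarrow> ugraph G \<and> verts G \<noteq> {} \<and> ugraph_connected G \<and> (\<nexists>cs. ugraph_cycle G cs)"

definition spanning_tree :: "'a ugraph \<Rightarrow> 'a ugraph \<Rightarrow> bool" where
  "spanning_tree T G \<longleftrightarrow> ugraph_tree T \<and> verts T = verts G \<and> edges T \<subseteq> edges G"

definition total_weight :: "('a set \<Rightarrow> real) \<Rightarrow> 'a ugraph \<Rightarrow> real" where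
  "total_weight w G = (\<Sum>e \<in> edges G. w e)"

definition min_spanning_tree :: "('a set \<Rightarrow> real) \<Rightarrow> 'a ugraph \<Rightarrow> 'a ugraph \<Rightarrow> bool" where
  "min_spanning_tree w T G \<longleftrightarrow> spanning_tree T G \<and>
     (\<forall>T'. spanning_tree T' G \<longrightarrow> total_weight w T \<le> total_weight w T')"

text \<open>\<open>P\<close> is a path and \<open>xs\<close> lists its vertices in consecutive order along \<open>P\<close>.\<close>

definition path_along :: "'a ugraph \<Rightarrow> 'a list \<Rightarrow> bool" where
  "path_along P xs \<longleftrightarrow> xs \<noteq> [] \<and> distinct xs \<and> verts P = set xs \<and>
     edges P = {{xs ! i, xs ! Suc i} | i. Suc i < length xs}"


section \<open>Minimum spanning paths of a finite metric space\<close>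

definition complete_ugraph :: "'a set \<Rightarrow> 'a ugraph" where
  "complete_ugraph X = \<lparr>verts = X, edges = {{x, y} | x y. x \<in> X \<and> y \<in> X \<and> x \<noteq> y}\<rparr>"

definition edge_weight :: "('a \<Rightarrow> 'a \<Rightarrow> real) \<Rightarrow> 'a set \<Rightarrow> real" where
  "edge_weight d e = (THE r. \<exists>x y. e = {x, y} \<and> r = d x y)"

lemma (in Metric_space) edge_weight_doubleton: "edge_weight d {x, y} = d x y"
  unfolding edge_weight_def
  by (rule the_equality) (auto simp: doubleton_eq_iff commute)

definition min_spanning_paths :: "('a \<Rightarrow> 'a \<Rightarrow> real) \<Rightarrow> 'a set \<Rightarrow> 'a ugraph set" where
  "min_spanning_paths d X =
     {P. min_spanning_tree (edge_weight d) P (complete_ugraph X) \<and> (\<exists>xs. path_along P xs)}"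

definition path_spectrum :: "('a \<Rightarrow> 'a \<Rightarrow> real) \<Rightarrow> 'a list \<Rightarrow> real list" where
  "path_spectrum d xs = map (\<lambda>i. d (xs ! i) (xs ! Suc i)) [0..<length xs - 1]"


section \<open>Diametrical graphs and representing trees\<close>

definition diametrical_graph :: "('a \<Rightarrow> 'a \<Rightarrow> real) \<Rightarrow> 'a set \<Rightarrow> 'a ugraph" where
  "diametrical_graph d X =
     \<lparr>verts = X, edges = {{u, v} | u v. u \<in> X \<and> v \<in> X \<and> u \<noteq> v \<and> d u v = diam d X}\<rparr>"

definition complete_multipartite :: "'a ugraph \<Rightarrow> 'a set set \<Rightarrow> bool" where
  "complete_multipartite G \<P> \<longleftrightarrow> partition_on (verts G) \<P> \<and>
     edges G = {{u, v} | u v. \<exists>A \<in> \<P>. \<exists>B \<in> \<P>. A \<noteq> B \<and> u \<in> A \<and> v \<in> B}"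

text \<open>In a complete multipartite graph, the parts are the classes of the non-adjacency relation.\<close>

definition graph_parts :: "'a ugraph \<Rightarrow> 'a set set" where
  "graph_parts G = verts G // {(u, v). u \<in> verts G \<and> v \<in> verts G \<and> {u, v} \<notin> edges G}"

lemma complete_multipartite_parts:
  assumes "complete_multipartite G \<P>"
  shows "\<P> = graph_parts G"
proof -
  have part: "partition_on (verts G) \<P>"
    and E: "edges G = {{u, v} | u v. \<exists>A \<in> \<P>. \<exists>B \<in> \<P>. A \<noteq> B \<and> u \<in> A \<and> v \<in> B}"
    using assms by (auto simp: complete_multipartite_def)
  have uniq: "A = B" if "A \<in> \<P>" "B \<in> \<P>" "u \<in> A" "u \<in> B" for A B u
    using part that by (auto simp: partition_on_def disjoint_def)
  have cls: "{(u, v). u \<in> verts G \<and> v \<in> verts G \<and> {u, v} \<notin> edges G} `` {u} = A"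
    if A: "A \<in> \<P>" "u \<in> A" for A u
  proof -
    have AV: "A \<subseteq> verts G"
      using part A by (auto simp: partition_on_def)
    have "{u, v} \<notin> edges G \<longleftrightarrow> v \<in> A" if v: "v \<in> verts G" for v
    proof -
      obtain B where B: "B \<in> \<P>" "v \<in> B"
        using part v by (auto simp: partition_on_def)
      show ?thesis
      proof
        assume nE: "{u, v} \<notin> edges G"
        have "A = B"
        proof (rule ccontr)
          assume "A \<noteq> B"
          then have "{u, v} \<in> edges G" unfolding E using A B by blast
          then show False using nE by simp
        qed
        then show "v \<in> A" using B by simp
      next
        assume vA: "v \<in> A"
        show "{u, v} \<notin> edges G"
        proof
          assume "{u, v} \<in> edges G"
          then obtain a b A' B' where *: "{u, v} = {a, b}" "A' \<in> \<P>" "B' \<in> \<P>" "A' \<noteq> B'" "a \<in> A'" "b \<in> B'"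
            unfolding E by blast
          then have "a \<in> A" "b \<in> A" using A vA by (auto simp: doubleton_eq_iff)
          then have "A' = A" "B' = A" using * A uniq by metis+
          then show False using * by simp
        qed
      qed
    qed
    then show ?thesis
      using AV A by auto
  qed
  have ne: "A \<noteq> {}" if "A \<in> \<P>" for A
    using part that by (auto simp: partition_on_def)
  have V: "verts G = \<Union>\<P>"
    using part by (auto simp: partition_on_def)
  let ?R = "{(u, v). u \<in> verts G \<and> v \<in> verts G \<and> {u, v} \<notin> edges G}"
  show ?thesis
  proof (intro set_eqI iffI)
    fix A assume A: "A \<in> \<P>"
    then obtain u where u: "u \<in> A" using ne by blast
    then have "u \<in> verts G" unfolding V using A by blast
    then have "?R `` {u} \<in> verts G // ?R" by (rule quotientI)
    then show "A \<in> graph_parts G"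
      unfolding graph_parts_def cls[OF A u] .
  next
    fix B assume "B \<in> graph_parts G"
    then obtain u where u: "u \<in> verts G" "B = ?R `` {u}"
      unfolding graph_parts_def by (rule quotientE)
    then obtain A where A: "A \<in> \<P>" "u \<in> A" unfolding V by blast
    show "B \<in> \<P>" unfolding u(2) cls[OF A] by (rule A(1))
  qed
qed

record 'v labeled_rooted_tree =
  nodes :: "'v set"
  root_node :: 'v
  children :: "'v \<Rightarrow> 'v set"
  label :: "'v \<Rightarrow> real"

definition internal_nodes :: "'v labeled_rooted_tree \<Rightarrow> 'v set" where
  "internal_nodes T = {v \<in> nodes T. children T v \<noteq> {}}"

definition strictly_binary :: "'v labeled_rooted_tree \<Rightarrow> bool" where
  "strictly_binary T \<longleftrightarrow> (\<forall>v \<in> internal_nodes T. card (children T v) = 2)"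

definition rep_children :: "('a \<Rightarrow> 'a \<Rightarrow> real) \<Rightarrow> 'a set \<Rightarrow> 'a set set" where
  "rep_children d A = (if diam d A > 0 then graph_parts (diametrical_graph d A) else {})"

inductive_set rep_nodes :: "('a \<Rightarrow> 'a \<Rightarrow> real) \<Rightarrow> 'a set \<Rightarrow> 'a set set" for d X where
  root: "X \<in> rep_nodes d X"
| child: "\<lbrakk>A \<in> rep_nodes d X; B \<in> rep_children d A\<rbrakk> \<Longrightarrow> B \<in> rep_nodes d X"

definition representing_tree :: "('a \<Rightarrow> 'a \<Rightarrow> real) \<Rightarrow> 'a set \<Rightarrow> 'a set labeled_rooted_tree" where
  "representing_tree d X =
     \<lparr>nodes = rep_nodes d X, root_node = X, children = rep_children d, label = diam d\<rparr>"

subsection \<open>Well-definedness of the construction\<close>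

lemma diam_ge:
  assumes "finite A" "x \<in> A" "y \<in> A"
  shows "d x y \<le> diam d A"
proof -
  have "d x y \<in> (\<lambda>(x, y). d x y) ` (A \<times> A)" using assms by force
  then show ?thesis
    unfolding diam_def using assms by (intro cSup_upper) (auto intro: bdd_above_finite)
qed

lemma diam_attained:
  assumes "finite A" "A \<noteq> {}"
  obtains x y where "x \<in> A" "y \<in> A" "d x y = diam d A"
proof -
  have "Sup ((\<lambda>(x, y). d x y) ` (A \<times> A)) \<in> (\<lambda>(x, y). d x y) ` (A \<times> A)"
    using assms by (subst cSup_eq_Max) (auto intro!: Max_in)
  then show ?thesis using that unfolding diam_def by auto
qed

lemma (in Metric_space) diam_pos_iff:
  assumes "finite A" "A \<noteq> {}" "A \<subseteq> M"
  shows "0 < diam d A \<longleftrightarrow> 2 \<le> card A"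
proof
  assume pos: "0 < diam d A"
  obtain x y where xy: "x \<in> A" "y \<in> A" "d x y = diam d A"
    using diam_attained assms by metis
  then have "x \<noteq> y" using pos assms by force
  then have "card {x, y} = 2" by simp
  then show "2 \<le> card A"
    using xy assms card_mono[of A "{x, y}"] by auto
next
  assume "2 \<le> card A"
  then obtain x y where "x \<in> A" "y \<in> A" "x \<noteq> y"
    by (metis One_nat_def Suc_1 assms(1) card_le_Suc0_iff_eq not_less_eq_eq)
  moreover from this have "0 < d x y" using assms by (metis mdist_pos_less subsetD)
  ultimately show "0 < diam d A" using diam_ge[OF assms(1), of _ _ d] by (meson less_le_trans)
qed

lemma (in Ultrametric_space) diametrical_graph_parts:
  assumes "finite A" "A \<subseteq> M" "2 \<le> card A"
  shows "graph_parts (diametrical_graph d A) = A // {(u, v). u \<in> A \<and> v \<in> A \<and> d u v < diam d A}"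
    and "complete_multipartite (diametrical_graph d A) (graph_parts (diametrical_graph d A))"
    and "2 \<le> card (graph_parts (diametrical_graph d A))"
proof -
  define R where "R = {(u, v). u \<in> A \<and> v \<in> A \<and> d u v < diam d A}"
  have ne: "A \<noteq> {}" using assms by auto
  have pos: "0 < diam d A" using diam_pos_iff[OF assms(1) ne assms(2)] assms by simp
  have le: "d u v \<le> diam d A" if "u \<in> A" "v \<in> A" for u v
    using diam_ge[OF assms(1) that] .
  have dz: "d u u = 0" if "u \<in> A" for u using that assms(2) by auto
  have E: "edges (diametrical_graph d A) = {{u, v} | u v. u \<in> A \<and> v \<in> A \<and> d u v = diam d A}"
    using dz pos by (fastforce simp: diametrical_graph_def)
  have V: "verts (diametrical_graph d A) = A" by (simp add: diametrical_graph_def)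
  have nadj: "{u, v} \<notin> edges (diametrical_graph d A) \<longleftrightarrow> d u v < diam d A"
    if "u \<in> A" "v \<in> A" for u v
  proof -
    have "{u, v} \<in> edges (diametrical_graph d A) \<longleftrightarrow> d u v = diam d A"
      unfolding E using that commute by (auto simp: doubleton_eq_iff)
    then show ?thesis using le[OF that] by auto
  qed
  have "{(u, v). u \<in> A \<and> v \<in> A \<and> {u, v} \<notin> edges (diametrical_graph d A)} = R"
    unfolding R_def using nadj by blast
  then have parts: "graph_parts (diametrical_graph d A) = A // R"
    unfolding graph_parts_def V by simp
  then show "graph_parts (diametrical_graph d A) = A // {(u, v). u \<in> A \<and> v \<in> A \<and> d u v < diam d A}"
    by (simp add: R_def)
  have eq: "equiv A R"
  proof (rule equivI)
    show "R \<subseteq> A \<times> A" by (auto simp: R_def)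
    show "refl_on A R" using pos dz by (auto simp: R_def refl_on_def)
    show "sym R" by (auto simp: R_def sym_def commute)
    show "trans R"
    proof (rule transI)
      fix x y z assume xyz: "(x, y) \<in> R" "(y, z) \<in> R"
      then have "d x z \<le> max (d x y) (d y z)"
        using assms(2) by (intro ultra) (auto simp: R_def)
      then show "(x, z) \<in> R" using xyz by (auto simp: R_def)
    qed
  qed
  have cls: "(u, v) \<notin> R \<longleftrightarrow> (\<exists>B \<in> A // R. \<exists>C \<in> A // R. B \<noteq> C \<and> u \<in> B \<and> v \<in> C)"
    if "u \<in> A" "v \<in> A" for u v
  proof
    assume "(u, v) \<notin> R"
    then have "R `` {u} \<noteq> R `` {v}"
      using eq that by (simp add: eq_equiv_class_iff)
    then show "\<exists>B \<in> A // R. \<exists>C \<in> A // R. B \<noteq> C \<and> u \<in> B \<and> v \<in> C"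
      using that eq by (meson equiv_class_self quotientI)
  next
    assume "\<exists>B \<in> A // R. \<exists>C \<in> A // R. B \<noteq> C \<and> u \<in> B \<and> v \<in> C"
    then show "(u, v) \<notin> R"
      using eq by (metis quotient_eq_iff)
  qed
  have nR: "(u, v) \<notin> R \<longleftrightarrow> d u v = diam d A" if "u \<in> A" "v \<in> A" for u v
    using le[OF that] that by (auto simp: R_def)
  have sub: "B \<subseteq> A" if "B \<in> A // R" for B
    using that by (auto simp: quotient_def R_def)
  have E2: "edges (diametrical_graph d A) =
      {{u, v} | u v. \<exists>B \<in> A // R. \<exists>C \<in> A // R. B \<noteq> C \<and> u \<in> B \<and> v \<in> C}"
  proof -
    have "u \<in> A \<and> v \<in> A \<and> d u v = diam d A \<longleftrightarrow>
        (\<exists>B \<in> A // R. \<exists>C \<in> A // R. B \<noteq> C \<and> u \<in> B \<and> v \<in> C)" for u v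
      using cls[of u v] nR[of u v] sub by blast
    then show ?thesis unfolding E by simp
  qed
  show "complete_multipartite (diametrical_graph d A) (graph_parts (diametrical_graph d A))"
    unfolding complete_multipartite_def parts V E2
    using partition_on_quotient[OF eq] by simp
  obtain x y where xy: "x \<in> A" "y \<in> A" "d x y = diam d A"
    using diam_attained[OF assms(1) ne] by metis
  then have "R `` {x} \<noteq> R `` {y}"
    using nR[of x y] eq by (simp add: eq_equiv_class_iff)
  then have "card {R `` {x}, R `` {y}} = 2" by simp
  moreover have "{R `` {x}, R `` {y}} \<subseteq> A // R" using xy by (auto intro: quotientI)
  moreover have "finite (A // R)"
    using assms(1) finite_quotient[of A R] by (auto simp: R_def)
  ultimately show "2 \<le> card (graph_parts (diametrical_graph d A))"
    unfolding parts using card_mono by metis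
qed

end

theory Submission
  imports Defs
begin

text \<open>
  Both conditions say that \<open>X\<close> contains no equilateral triangle, that is, no three distinct points
  with all mutual distances equal.

  For the tree: points chosen from three different children of a node are at mutual distance equal
  to its diameter. Conversely, the smallest node containing an equilateral triangle has the side
  length as its diameter, since otherwise the triangle would lie in a single child; so the three
  vertices lie in three different children (\<open>strictly_binary_iff_no_equilateral\<close>).

  For the path \<open>x\<^sub>0, x\<^sub>1, \<dots>\<close>: it is minimal, so exchanging the edge
  \<open>{x\<^sub>i, x\<^sub>i\<^sub>+\<^sub>1}\<close> for \<open>{x\<^sub>i, x\<^sub>j}\<close> with \<open>i < j\<close> cannot make it lighter, and this forces
  \<open>d x\<^sub>i x\<^sub>j\<close> to be the maximum of the path weights between the two positions
  (\<open>path_step_le_dist\<close>, \<open>ultrametric_path_bound\<close>). Hence three points at positions \<open>a < b < c\<close>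
  form an equilateral triangle exactly when the maximum over the steps from \<open>a\<close> to \<open>c\<close> is attained
  both before and after \<open>b\<close>. Such positions exist exactly when two equal path weights have nothing
  larger between them (\<open>no_equilateral_iff_repeats_separated\<close>).
\<close>

section \<open>Equilateral triangles and the representing tree\<close>

definition equilateral :: "('a \<Rightarrow> 'a \<Rightarrow> real) \<Rightarrow> 'a \<Rightarrow> 'a \<Rightarrow> 'a \<Rightarrow> bool" where
  "equilateral d x y z \<longleftrightarrow> 0 < d x y \<and> d x z = d x y \<and> d y z = d x y"

context Ultrametric_space
begin

lemma rep_children_eq:
  assumes "finite A" "A \<noteq> {}" "A \<subseteq> M" "0 < diam d A"
  shows "rep_children d A = A // {(u, v). u \<in> A \<and> v \<in> A \<and> d u v < diam d A}"
  using assms diametrical_graph_parts(1)[of A] diam_pos_iff[of A] by (simp add: rep_children_def)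

lemma rep_nodes_subset:
  assumes "A \<in> rep_nodes d X" "finite X" "X \<noteq> {}" "X \<subseteq> M"
  shows "A \<subseteq> X \<and> A \<noteq> {}"
  using assms(1)
proof induction
  case root
  then show ?case using assms by simp
next
  case (child A B)
  have pos: "0 < diam d A"
    using child.hyps(2) by (auto simp: rep_children_def split: if_splits)
  have "finite A" "A \<subseteq> M" "A \<noteq> {}"
    using child.IH assms finite_subset by auto
  then obtain u where "u \<in> A" "B = {(u, v). u \<in> A \<and> v \<in> A \<and> d u v < diam d A} `` {u}"
    using child.hyps(2) pos rep_children_eq[of A] by (auto elim!: quotientE)
  then have "B \<subseteq> A" "u \<in> B"
    using pos \<open>A \<subseteq> M\<close> by auto
  then show ?case using child.IH by blast
qed

lemma dist_different_children:
  assumes A: "finite A" "A \<noteq> {}" "A \<subseteq> M"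
    and BC: "B \<in> rep_children d A" "C \<in> rep_children d A" "B \<noteq> C" "u \<in> B" "v \<in> C"
  shows "d u v = diam d A"
proof -
  let ?G = "diametrical_graph d A"
  have pos: "0 < diam d A"
    using BC by (auto simp: rep_children_def split: if_splits)
  then have "complete_multipartite ?G (rep_children d A)"
    using diametrical_graph_parts(2)[of A] diam_pos_iff[of A] A by (simp add: rep_children_def)
  then have "{u, v} \<in> edges ?G"
    using BC unfolding complete_multipartite_def by blast
  then show ?thesis
    using commute by (auto simp: diametrical_graph_def doubleton_eq_iff)
qed

lemma rep_children_of_equilateral:
  assumes A: "finite A" "A \<subseteq> M"
    and xyz: "x \<in> A" "y \<in> A" "z \<in> A" "equilateral d x y z" "d x y = diam d A"
  shows "3 \<le> card (rep_children d A)"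
proof -
  define R where "R = {(u, v). u \<in> A \<and> v \<in> A \<and> d u v < diam d A}"
  have pos: "0 < diam d A"
    using xyz by (simp add: equilateral_def)
  have ch: "rep_children d A = A // R"
    unfolding R_def using A xyz(1) pos by (intro rep_children_eq) auto
  have self: "u \<in> R `` {u}" if "u \<in> A" for u
    using that pos A by (auto simp: R_def)
  have "y \<notin> R `` {x}" "z \<notin> R `` {x}" "z \<notin> R `` {y}"
    using xyz by (auto simp: R_def equilateral_def)
  then have "card {R `` {x}, R `` {y}, R `` {z}} = 3"
    using self[OF xyz(2)] self[OF xyz(3)] by (auto simp: card_insert_if)
  moreover have "{R `` {x}, R `` {y}, R `` {z}} \<subseteq> A // R"
    using xyz by (auto intro: quotientI)
  moreover have "finite (A // R)"
    using A by (intro finite_quotient) (auto simp: R_def)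
  ultimately show ?thesis
    unfolding ch using card_mono by metis
qed

text \<open>The node sought is the smallest one containing the triangle: if its diameter exceeded the
  side length, the triangle would lie in one of its children.\<close>

lemma ex_rep_node_of_equilateral:
  assumes X: "finite X" "X \<subseteq> M"
    and xyz: "x \<in> X" "y \<in> X" "z \<in> X" "equilateral d x y z"
  shows "\<exists>A \<in> rep_nodes d X. x \<in> A \<and> y \<in> A \<and> z \<in> A \<and> diam d A = d x y"
proof -
  let ?Q = "\<lambda>A. A \<in> rep_nodes d X \<and> x \<in> A \<and> y \<in> A \<and> z \<in> A"
  have "?Q X" using xyz rep_nodes.root by blast
  then obtain A where A: "?Q A" and least: "\<And>B. ?Q B \<Longrightarrow> card A \<le> card B"
    using arg_min_nat_lemma[of ?Q X card] by blast
  have sub: "A \<subseteq> X" using rep_nodes_subset[of A X] A X xyz by blast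
  have fin: "finite A" and AM: "A \<subseteq> M"
    using sub X finite_subset by auto
  have "\<not> d x y < diam d A"
  proof
    assume lt: "d x y < diam d A"
    define R where "R = {(u, v). u \<in> A \<and> v \<in> A \<and> d u v < diam d A}"
    have pos: "0 < diam d A" using lt xyz(4) by (simp add: equilateral_def)
    have ch: "R `` {x} \<in> rep_children d A"
    proof -
      have "A \<noteq> {}" using A by blast
      then have "rep_children d A = A // R"
        unfolding R_def using rep_children_eq fin AM pos by blast
      then show ?thesis using A by (simp add: quotientI)
    qed
    have "d x x = 0" using A AM by auto
    then have "?Q (R `` {x})"
      using A lt pos xyz(4) ch rep_nodes.child[of A d X]
      by (auto simp: R_def equilateral_def)
    then have "card A \<le> card (R `` {x})" by (rule least)
    moreover have "R `` {x} \<subseteq> A" by (auto simp: R_def)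
    ultimately have all: "R `` {x} = A" using fin by (simp add: card_seteq)
    obtain u v where uv: "u \<in> A" "v \<in> A" "d u v = diam d A"
      using diam_attained[of A d] fin A by blast
    have "d x u < diam d A" "d x v < diam d A"
      using all uv by (auto simp: R_def)
    moreover have "d u v \<le> max (d u x) (d x v)"
      using uv A AM by (intro ultra) auto
    ultimately show False using uv(3) commute[of u x] by linarith
  qed
  then have "diam d A = d x y"
    using diam_ge[OF fin, of x y d] A by fastforce
  then show ?thesis using A by blast
qed

theorem strictly_binary_iff_no_equilateral:
  assumes X: "finite X" "X \<noteq> {}" "X \<subseteq> M"
  shows "strictly_binary (representing_tree d X) \<longleftrightarrow>
    \<not> (\<exists>x \<in> X. \<exists>y \<in> X. \<exists>z \<in> X. equilateral d x y z)"
proof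
  assume bin: "strictly_binary (representing_tree d X)"
  show "\<not> (\<exists>x \<in> X. \<exists>y \<in> X. \<exists>z \<in> X. equilateral d x y z)"
  proof
    assume "\<exists>x \<in> X. \<exists>y \<in> X. \<exists>z \<in> X. equilateral d x y z"
    then obtain x y z where xyz: "x \<in> X" "y \<in> X" "z \<in> X" "equilateral d x y z" by blast
    then obtain A where A: "A \<in> rep_nodes d X" "x \<in> A" "y \<in> A" "z \<in> A" "diam d A = d x y"
      using ex_rep_node_of_equilateral X by blast
    then have "finite A" "A \<subseteq> M"
      using rep_nodes_subset[of A X] X finite_subset by auto
    then have "3 \<le> card (rep_children d A)"
      using rep_children_of_equilateral A xyz(4) by metis
    moreover from this have "rep_children d A \<noteq> {}" by auto
    ultimately show False
      using bin A(1) by (force simp: strictly_binary_def internal_nodes_def representing_tree_def)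
  qed
next
  assume no: "\<not> (\<exists>x \<in> X. \<exists>y \<in> X. \<exists>z \<in> X. equilateral d x y z)"
  have "card (rep_children d A) = 2" if node: "A \<in> rep_nodes d X" and int: "rep_children d A \<noteq> {}" for A
  proof -
    have sub: "A \<subseteq> X" "A \<noteq> {}" using rep_nodes_subset[OF node X] by auto
    then have fin: "finite A" and AM: "A \<subseteq> M" using X finite_subset by auto
    have pos: "0 < diam d A"
      using int by (auto simp: rep_children_def split: if_splits)
    then have "2 \<le> card (rep_children d A)"
      using diametrical_graph_parts(3)[OF fin AM] diam_pos_iff[OF fin sub(2) AM]
      by (simp add: rep_children_def)
    moreover have "\<not> 3 \<le> card (rep_children d A)"
    proof
      assume "3 \<le> card (rep_children d A)"
      then obtain S where "S \<subseteq> rep_children d A" "card S = 3"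
        using obtain_subset_with_card_n by metis
      then obtain B C D where BCD: "B \<in> rep_children d A" "C \<in> rep_children d A"
        "D \<in> rep_children d A" "B \<noteq> C" "B \<noteq> D" "C \<noteq> D"
        by (auto simp: card_3_iff)
      have child: "K \<subseteq> X \<and> K \<noteq> {}" if "K \<in> rep_children d A" for K
        using rep_nodes_subset[OF rep_nodes.child[OF node that] X] .
      obtain x y z where xyz: "x \<in> B" "y \<in> C" "z \<in> D"
        using child BCD by blast
      note dist = dist_different_children[OF fin sub(2) AM]
      have "d x y = diam d A" "d x z = diam d A" "d y z = diam d A"
        using dist[OF BCD(1,2,4) xyz(1,2)] dist[OF BCD(1,3,5) xyz(1,3)]
          dist[OF BCD(2,3,6) xyz(2,3)] by simp_all
      then have "equilateral d x y z" using pos by (simp add: equilateral_def)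
      then show False using no child BCD xyz by blast
    qed
    ultimately show ?thesis by simp
  qed
  then show "strictly_binary (representing_tree d X)"
    by (simp add: strictly_binary_def internal_nodes_def representing_tree_def)
qed

end


section \<open>Distances along a minimum spanning path\<close>

text \<open>The rank excludes cycles: a vertex of largest rank on a cycle could be adjacent there only
  to its parent, but it has two neighbours. It also makes the walk along parents end at the root,
  which gives connectedness.\<close>

lemma ugraph_tree_of_parents:
  fixes rank :: "'a \<Rightarrow> nat"
  assumes root: "r \<in> verts G"
    and parent: "\<And>v. v \<in> verts G \<Longrightarrow> v \<noteq> r \<Longrightarrow> p v \<in> verts G \<and> rank (p v) < rank v"
    and edges: "edges G = {{v, p v} | v. v \<in> verts G \<and> v \<noteq> r}"
  shows "ugraph_tree G"
  unfolding ugraph_tree_def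
proof (intro conjI)
  show "ugraph G"
    unfolding ugraph_def edges using parent by fastforce
  show "verts G \<noteq> {}" using root by blast
  let ?E = "{(a, b). {a, b} \<in> edges G}"
  have to_root: "(v, r) \<in> ?E\<^sup>*" if "v \<in> verts G" for v
    using that
  proof (induction "rank v" arbitrary: v rule: less_induct)
    case less
    show ?case
    proof (cases "v = r")
      case False
      then have "(v, p v) \<in> ?E" using less.prems by (auto simp: edges)
      moreover have "(p v, r) \<in> ?E\<^sup>*" using less parent False by blast
      ultimately show ?thesis by (rule converse_rtrancl_into_rtrancl)
    qed simp
  qed
  have "sym (?E\<^sup>*)" by (intro sym_rtrancl symI) (auto simp: insert_commute)
  then show "ugraph_connected G"
    unfolding ugraph_connected_def using to_root by (meson rtrancl_trans symD)
  show "\<nexists>cs. ugraph_cycle G cs"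
  proof
    assume "\<exists>cs. ugraph_cycle G cs"
    then obtain cs where len: "3 \<le> length cs" and dist: "distinct cs"
      and step: "\<And>i. i < length cs \<Longrightarrow> {cs ! i, cs ! (Suc i mod length cs)} \<in> edges G"
      unfolding ugraph_cycle_def by blast
    let ?n = "length cs"
    obtain t where t: "t < ?n" and top: "\<And>i. i < ?n \<Longrightarrow> rank (cs ! i) \<le> rank (cs ! t)"
    proof -
      have "finite (rank ` set cs)" "rank ` set cs \<noteq> {}" using len by auto
      then have "Max (rank ` set cs) \<in> rank ` set cs" by (rule Max_in)
      then obtain t where "t < ?n" "Max (rank ` set cs) = rank (cs ! t)"
        by (auto simp: in_set_conv_nth)
      moreover have "rank (cs ! i) \<le> Max (rank ` set cs)" if "i < ?n" for i
        using that by simp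
      ultimately show ?thesis using that by simp
    qed
    have only: "cs ! i = p (cs ! t)" if i: "i < ?n" "{cs ! t, cs ! i} \<in> edges G" for i
    proof -
      obtain v where v: "{cs ! t, cs ! i} = {v, p v}" "v \<in> verts G" "v \<noteq> r"
        using i(2) edges by blast
      have "rank (p v) < rank v" using parent v by blast
      then have "v \<noteq> cs ! i \<or> p v \<noteq> cs ! t" using top[OF i(1)] by auto
      then show ?thesis using v(1) by (auto simp: doubleton_eq_iff)
    qed
    define a where "a = Suc t mod ?n"
    define b where "b = (if t = 0 then ?n - 1 else t - 1)"
    have ab: "a < ?n" "b < ?n" "a \<noteq> b" "Suc b mod ?n = t"
      using t len by (auto simp: a_def b_def mod_Suc)
    have "cs ! a = p (cs ! t)"
      using only[OF ab(1)] step[OF t] by (simp add: a_def)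
    moreover have "cs ! b = p (cs ! t)"
      using only[OF ab(2)] step[OF ab(2)] ab(4) by (simp add: insert_commute)
    ultimately have "cs ! a = cs ! b" by simp
    then show False
      using dist ab(1-3) nth_eq_iff_index_eq by blast
  qed
qed

text \<open>Rooted at position \<open>j\<close>, the path has the parent map "one step towards \<open>j\<close>"; redirecting
  the parent of position \<open>i\<close> straight to \<open>j\<close> leaves the distance from \<open>j\<close> a valid rank.\<close>

lemma ugraph_tree_exchange:
  assumes xs: "distinct xs" and ij: "i < j" "j < length xs"
  shows "ugraph_tree \<lparr>verts = set xs,
    edges = insert {xs ! i, xs ! j} {{xs ! m, xs ! Suc m} | m. Suc m < length xs \<and> m \<noteq> i}\<rparr>"
    (is "ugraph_tree \<lparr>verts = _, edges = ?E\<rparr>")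
proof -
  define pos where "pos v = (THE m. m < length xs \<and> xs ! m = v)" for v
  have pos: "pos (xs ! m) = m" if "m < length xs" for m
    unfolding pos_def using that xs by (intro the_equality) (auto simp: nth_eq_iff_index_eq)
  define q where "q m = (if m = i then j else if m < j then Suc m else m - 1)" for m
  define p where "p v = xs ! q (pos v)" for v
  have q: "q m < length xs" if "m < length xs" for m
    using that ij by (auto simp: q_def)
  have "?E = {{xs ! m, xs ! q m} | m. m < length xs \<and> m \<noteq> j}" (is "_ = ?F")
  proof (intro equalityI subsetI)
    fix e assume "e \<in> ?E"
    then consider "e = {xs ! i, xs ! j}"
      | m where "e = {xs ! m, xs ! Suc m}" "Suc m < length xs" "m \<noteq> i" by blast
    then show "e \<in> ?F"
    proof cases
      case 1
      then have "e = {xs ! i, xs ! q i}" by (simp add: q_def)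
      then show ?thesis using ij by (intro CollectI exI[of _ i]) simp
    next
      case 2
      show ?thesis
      proof (cases "m < j")
        case True
        then have "e = {xs ! m, xs ! q m}" using 2 by (simp add: q_def)
        then show ?thesis using 2 True by (intro CollectI exI[of _ m]) simp
      next
        case False
        then have "e = {xs ! Suc m, xs ! q (Suc m)}" using 2 ij by (auto simp: q_def)
        then show ?thesis using 2 False by (intro CollectI exI[of _ "Suc m"]) simp
      qed
    qed
  next
    fix e assume "e \<in> ?F"
    then obtain m where m: "e = {xs ! m, xs ! q m}" "m < length xs" "m \<noteq> j" by blast
    consider "m = i" | "m \<noteq> i" "m < j" | "j < m" using m ij by linarith
    then show "e \<in> ?E"
    proof cases
      case 1
      then show ?thesis using m by (simp add: q_def)
    next
      case 2
      then have "e = {xs ! m, xs ! Suc m}" "Suc m < length xs" using m ij by (auto simp: q_def)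
      then show ?thesis using 2 by blast
    next
      case 3
      then have "e = {xs ! (m - 1), xs ! Suc (m - 1)}" "Suc (m - 1) < length xs" "m - 1 \<noteq> i"
        using m ij by (auto simp: q_def)
      then show ?thesis by blast
    qed
  qed
  also have "\<dots> = {{v, p v} | v. v \<in> set xs \<and> v \<noteq> xs ! j}"
  proof (intro equalityI subsetI)
    fix e assume "e \<in> {{xs ! m, xs ! q m} | m. m < length xs \<and> m \<noteq> j}"
    then obtain m where m: "e = {xs ! m, xs ! q m}" "m < length xs" "m \<noteq> j" by blast
    then have "e = {xs ! m, p (xs ! m)}" "xs ! m \<in> set xs" "xs ! m \<noteq> xs ! j"
      using ij xs by (auto simp: p_def pos nth_eq_iff_index_eq)
    then show "e \<in> {{v, p v} | v. v \<in> set xs \<and> v \<noteq> xs ! j}" by blast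
  qed (force simp: p_def pos in_set_conv_nth)
  finally have E: "?E = {{v, p v} | v. v \<in> set xs \<and> v \<noteq> xs ! j}" .
  define rank where "rank v = (if pos v < j then j - pos v else pos v - j)" for v
  show ?thesis
  proof (rule ugraph_tree_of_parents[where r = "xs ! j" and p = p and rank = rank])
    fix v assume "v \<in> verts \<lparr>verts = set xs, edges = ?E\<rparr>" "v \<noteq> xs ! j"
    then obtain m where m: "m < length xs" "v = xs ! m" "m \<noteq> j"
      by (auto simp: in_set_conv_nth)
    then show "p v \<in> verts \<lparr>verts = set xs, edges = ?E\<rparr> \<and> rank (p v) < rank v"
      using q[OF m(1)] ij by (auto simp: rank_def p_def pos) (auto simp: q_def split: if_splits)
  qed (use ij in \<open>simp_all add: E\<close>)
qed

lemma finite_path_edges: "finite {{xs ! i, xs ! Suc i} | i. Suc i < length xs}"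
proof -
  have "{{xs ! i, xs ! Suc i} | i. Suc i < length xs} \<subseteq> Pow (set xs)" by auto
  then show ?thesis using finite_subset by blast
qed

context Ultrametric_space
begin

text \<open>The inequality compares the one edge removed with the one edge added in
  \<open>ugraph_tree_exchange\<close>.\<close>

lemma first_step_le_dist:
  assumes P: "P \<in> min_spanning_paths d M" "path_along P xs" and ij: "i < j" "j < length xs"
  shows "d (xs ! i) (xs ! Suc i) \<le> d (xs ! i) (xs ! j)"
proof -
  have dist: "distinct xs" and edg: "edges P = {{xs ! m, xs ! Suc m} | m. Suc m < length xs}"
    using P(2) by (auto simp: path_along_def)
  have mst: "min_spanning_tree (edge_weight d) P (complete_ugraph M)"
    using P(1) by (simp add: min_spanning_paths_def)
  have setM: "set xs = M"
    using mst P(2)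
    by (simp add: min_spanning_tree_def spanning_tree_def path_along_def complete_ugraph_def)
  define e where "e = {xs ! i, xs ! Suc i}"
  define f where "f = {xs ! i, xs ! j}"
  define T where "T = \<lparr>verts = M,
    edges = insert f {{xs ! m, xs ! Suc m} | m. Suc m < length xs \<and> m \<noteq> i}\<rparr>"
  have eP: "e \<in> edges P" using ij by (auto simp: edg e_def)
  have inj: "{xs ! m, xs ! Suc m} = e \<longleftrightarrow> m = i" if "Suc m < length xs" for m
    using that ij dist by (auto simp: e_def doubleton_eq_iff nth_eq_iff_index_eq)
  have ET: "edges T = insert f (edges P - {e})"
    using inj by (auto simp: T_def edg)
  have "ugraph_tree T"
    using ugraph_tree_exchange[OF dist ij] by (simp add: T_def f_def setM)
  moreover have "edges T \<subseteq> edges (complete_ugraph M)"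
  proof -
    have "edges P \<subseteq> edges (complete_ugraph M)"
      using mst by (simp add: min_spanning_tree_def spanning_tree_def)
    moreover have "xs ! i \<in> M" "xs ! j \<in> M" "xs ! i \<noteq> xs ! j"
      using ij dist setM by (auto simp: nth_eq_iff_index_eq)
    then have "f \<in> edges (complete_ugraph M)"
      by (auto simp: f_def complete_ugraph_def)
    ultimately show ?thesis unfolding ET by blast
  qed
  ultimately have "spanning_tree T (complete_ugraph M)"
    by (simp add: spanning_tree_def T_def complete_ugraph_def)
  then have "sum (edge_weight d) (edges P) \<le> sum (edge_weight d) (edges T)"
    using mst by (simp add: min_spanning_tree_def total_weight_def)
  also have "\<dots> \<le> edge_weight d f + sum (edge_weight d) (edges P - {e})"
    unfolding ET using finite_path_edges[of xs]
    by (cases "f \<in> edges P - {e}")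
      (auto simp: edg sum.insert insert_absorb f_def edge_weight_doubleton)
  also have "\<dots> = edge_weight d f + (sum (edge_weight d) (edges P) - edge_weight d e)"
    using finite_path_edges[of xs] eP by (simp add: sum_diff1 edg)
  finally show ?thesis by (simp add: e_def f_def edge_weight_doubleton)
qed

text \<open>The point \<open>x\<^sub>i\<close> can be moved along the path up to \<open>x\<^sub>k\<close> without its distance from
  \<open>x\<^sub>j\<close> growing, since by \<open>first_step_le_dist\<close> each step is at most that distance.\<close>

lemma path_step_le_dist:
  assumes P: "P \<in> min_spanning_paths d M" "path_along P xs"
    and ij: "i \<le> k" "k < j" "j < length xs" and sub: "set xs \<subseteq> M"
  shows "d (xs ! k) (xs ! Suc k) \<le> d (xs ! i) (xs ! j)"
  using ij(1)
proof (induction rule: inc_induct)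
  case base
  show ?case using first_step_le_dist[OF P ij(2,3)] .
next
  case (step m)
  have "d (xs ! Suc m) (xs ! j) \<le> max (d (xs ! Suc m) (xs ! m)) (d (xs ! m) (xs ! j))"
    using step ij by (intro ultra subsetD[OF sub] nth_mem) auto
  moreover have "d (xs ! m) (xs ! Suc m) \<le> d (xs ! m) (xs ! j)"
    using first_step_le_dist[OF P] step ij by auto
  ultimately show ?case
    using step.IH commute[of "xs ! m" "xs ! Suc m"] by linarith
qed

lemma ultrametric_path_bound:
  assumes "i < j" "j < length xs" "set xs \<subseteq> M"
  shows "\<exists>k. i \<le> k \<and> k < j \<and> d (xs ! i) (xs ! j) \<le> d (xs ! k) (xs ! Suc k)"
  using assms(1,2)
proof (induction j)
  case (Suc j)
  show ?case
  proof (cases "i = j")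
    case True
    then show ?thesis by auto
  next
    case False
    then have "i < j" "j < length xs" using Suc.prems by auto
    then obtain k where k: "i \<le> k" "k < j" "d (xs ! i) (xs ! j) \<le> d (xs ! k) (xs ! Suc k)"
      using Suc.IH by blast
    have "d (xs ! i) (xs ! Suc j) \<le> max (d (xs ! i) (xs ! j)) (d (xs ! j) (xs ! Suc j))"
      using Suc.prems by (intro ultra subsetD[OF assms(3)] nth_mem) auto
    then consider "d (xs ! i) (xs ! Suc j) \<le> d (xs ! k) (xs ! Suc k)"
      | "d (xs ! i) (xs ! Suc j) \<le> d (xs ! j) (xs ! Suc j)"
      using k(3) by linarith
    then show ?thesis
    proof cases
      case 1
      then show ?thesis using k by (intro exI[of _ k]) simp
    next
      case 2
      then show ?thesis using \<open>i < j\<close> by (intro exI[of _ j]) simp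
    qed
  qed
qed simp


section \<open>Equilateral triangles and the path spectrum\<close>

lemma dist_eq_max_path_step:
  assumes P: "P \<in> min_spanning_paths d M" "path_along P xs"
    and ij: "i < j" "j < length xs" and sub: "set xs \<subseteq> M"
  shows "\<exists>k. i \<le> k \<and> k < j \<and> d (xs ! i) (xs ! j) = d (xs ! k) (xs ! Suc k)"
  using ultrametric_path_bound[OF ij sub] path_step_le_dist[OF P _ _ ij(2) sub]
  by (meson order_antisym)

text \<open>Two equal steps \<open>i < j\<close> with nothing larger between them make \<open>x\<^sub>i, x\<^sub>i\<^sub>+\<^sub>1, x\<^sub>j\<^sub>+\<^sub>1\<close>
  equilateral; in the other direction, the maximal steps before and after the middle vertex of an
  equilateral triangle form such a pair.\<close>

lemma no_equilateral_iff_repeats_separated: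
  assumes P: "P \<in> min_spanning_paths d M" "path_along P xs" and setM: "set xs = M"
  shows "\<not> (\<exists>x \<in> M. \<exists>y \<in> M. \<exists>z \<in> M. equilateral d x y z) \<longleftrightarrow>
    (\<forall>i j. i < j \<and> Suc j < length xs \<and> d (xs ! i) (xs ! Suc i) = d (xs ! j) (xs ! Suc j) \<longrightarrow>
      (\<exists>k. i < k \<and> k < j \<and> d (xs ! k) (xs ! Suc k) > d (xs ! i) (xs ! Suc i)))"
    (is "?no \<longleftrightarrow> ?sep")
proof
  have sub: "set xs \<subseteq> M" using setM by simp
  have dist: "distinct xs" using P(2) by (simp add: path_along_def)
  note lower = path_step_le_dist[OF P _ _ _ sub]
  note attained = dist_eq_max_path_step[OF P _ _ sub]
  {
    assume no: ?no
    show ?sep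
    proof (intro allI impI, elim conjE, rule ccontr)
      fix i j assume ij: "i < j" "Suc j < length xs"
        and eq: "d (xs ! i) (xs ! Suc i) = d (xs ! j) (xs ! Suc j)"
        and "\<nexists>k. i < k \<and> k < j \<and> d (xs ! k) (xs ! Suc k) > d (xs ! i) (xs ! Suc i)"
      then have max: "d (xs ! k) (xs ! Suc k) \<le> d (xs ! i) (xs ! Suc i)" if "i \<le> k" "k \<le> j" for k
        using that by (metis le_less linorder_not_less order_refl)
      have side: "d (xs ! a) (xs ! Suc j) = d (xs ! i) (xs ! Suc i)" if a: "i \<le> a" "a \<le> j" for a
      proof (rule antisym)
        obtain k where "a \<le> k" "k < Suc j" "d (xs ! a) (xs ! Suc j) = d (xs ! k) (xs ! Suc k)"
          using attained[of a "Suc j"] a ij by auto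
        then show "d (xs ! a) (xs ! Suc j) \<le> d (xs ! i) (xs ! Suc i)"
          using max[of k] a by simp
        show "d (xs ! i) (xs ! Suc i) \<le> d (xs ! a) (xs ! Suc j)"
          unfolding eq using a ij by (intro lower) auto
      qed
      have mem: "xs ! i \<in> M" "xs ! Suc i \<in> M" "xs ! Suc j \<in> M"
        using ij setM nth_mem by auto
      have "xs ! i \<noteq> xs ! Suc i" using ij dist by (simp add: nth_eq_iff_index_eq)
      then have "equilateral d (xs ! i) (xs ! Suc i) (xs ! Suc j)"
        unfolding equilateral_def using mem side[of i] side[of "Suc i"] ij by simp
      then show False using no mem by blast
    qed
  }
  {
    assume sep: ?sep
    have ordered: False
      if abc: "a < b" "b < c" "c < length xs" and r: "d (xs ! a) (xs ! b) = r"
        "d (xs ! b) (xs ! c) = r" "d (xs ! a) (xs ! c) = r" for a b c r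
    proof -
      obtain i where i: "a \<le> i" "i < b" "d (xs ! i) (xs ! Suc i) = r"
        using attained[of a b] abc r by auto
      obtain j where j: "b \<le> j" "j < c" "d (xs ! j) (xs ! Suc j) = r"
        using attained[of b c] abc r by auto
      obtain k where k: "i < k" "k < j" "d (xs ! k) (xs ! Suc k) > r"
        using sep[rule_format, of i j] i j abc by auto
      have "d (xs ! k) (xs ! Suc k) \<le> r"
        using lower[of a k c] k i j abc r by simp
      then show False using k by simp
    qed
    show ?no
    proof
      assume "\<exists>x \<in> M. \<exists>y \<in> M. \<exists>z \<in> M. equilateral d x y z"
      then obtain x y z where xyz: "x \<in> M" "y \<in> M" "z \<in> M" "equilateral d x y z" by blast
      then obtain a b c where abc: "a < length xs" "b < length xs" "c < length xs"
        "x = xs ! a" "y = xs ! b" "z = xs ! c"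
        using setM by (metis in_set_conv_nth)
      define r where "r = d x y"
      have r: "0 < r" "d x y = r" "d x z = r" "d y z = r" "d y x = r" "d z x = r" "d z y = r"
        using xyz(4) commute by (auto simp: equilateral_def r_def)
      have "d x x = 0" "d y y = 0" using xyz by auto
      then have "a \<noteq> b" "a \<noteq> c" "b \<noteq> c" using r abc by auto
      then consider "a < b" "b < c" | "a < c" "c < b" | "b < a" "a < c"
        | "b < c" "c < a" | "c < a" "a < b" | "c < b" "b < a" by linarith
      then show False
        by cases (use ordered r abc in blast)+
    qed
  }
qed

end

lemma nth_path_spectrum:
  "i < length xs - 1 \<Longrightarrow> path_spectrum d xs ! i = d (xs ! i) (xs ! Suc i)"
  by (simp add: path_spectrum_def)

theorem proposition3p2:
  fixes X :: "'a set" and d :: "'a \<Rightarrow> 'a \<Rightarrow> real" and n :: nat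
    and P :: "'a ugraph" and xs :: "'a list" and s :: "real list"
  assumes "Ultrametric_space X d"
    and "finite X" and "X \<noteq> {}" and "card X = n"
    and "P \<in> min_spanning_paths d X"
    and "path_along P xs"
    and "s = path_spectrum d xs"
  shows "strictly_binary (representing_tree d X) \<longleftrightarrow>
    (\<forall>i j. i < j \<and> j < n - 1 \<and> s ! i = s ! j \<longrightarrow>
       (\<exists>k. i < k \<and> k < j \<and> s ! k > s ! i))"
proof -
  interpret Ultrametric_space X d by (rule assms(1))
  have setX: "set xs = X"
    using assms(5,6)
    by (simp add: min_spanning_paths_def min_spanning_tree_def spanning_tree_def path_along_def
        complete_ugraph_def)
  then have n: "length xs = n"
    using assms(4,6) distinct_card[of xs] by (simp add: path_along_def)
  have s: "s ! i = d (xs ! i) (xs ! Suc i)" if "i < n - 1" for i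
    using that by (simp add: assms(7) n nth_path_spectrum)
  have "strictly_binary (representing_tree d X) \<longleftrightarrow>
    (\<forall>i j. i < j \<and> Suc j < length xs \<and> d (xs ! i) (xs ! Suc i) = d (xs ! j) (xs ! Suc j) \<longrightarrow>
      (\<exists>k. i < k \<and> k < j \<and> d (xs ! k) (xs ! Suc k) > d (xs ! i) (xs ! Suc i)))"
    using strictly_binary_iff_no_equilateral[OF assms(2,3)]
      no_equilateral_iff_repeats_separated[OF assms(5,6) setX] by simp
  also have "\<dots> \<longleftrightarrow> (\<forall>i j. i < j \<and> j < n - 1 \<and> s ! i = s ! j \<longrightarrow>
       (\<exists>k. i < k \<and> k < j \<and> s ! k > s ! i))"
  proof (intro all_cong1)
    fix i j
    show "(i < j \<and> Suc j < length xs \<and> d (xs ! i) (xs ! Suc i) = d (xs ! j) (xs ! Suc j) \<longrightarrow>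
        (\<exists>k. i < k \<and> k < j \<and> d (xs ! k) (xs ! Suc k) > d (xs ! i) (xs ! Suc i))) \<longleftrightarrow>
      (i < j \<and> j < n - 1 \<and> s ! i = s ! j \<longrightarrow> (\<exists>k. i < k \<and> k < j \<and> s ! k > s ! i))"
    proof (cases "i < j \<and> j < n - 1")
      case True
      then have "s ! k = d (xs ! k) (xs ! Suc k)" if "k \<le> j" for k
        using s[of k] that by simp
      then show ?thesis using True n by (auto simp: less_imp_le)
    qed (auto simp: n)
  qed
  finally show ?thesis .
qed

end
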